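(* Let $M_P$ and $M'_P$ be two $\downarrow$-lovely pairs for $T$. Let $\bar a$ be a P-independent very small tuple from $M$, and let $\bar a'$ be a P-independent tuple of the same length from $M'$. If $\bar a\equiv^1\bar a'$ and $\bar a$, $\bar a'$ have the same P-type, then $\bar a\equiv^2\bar a'$ (that is, the $\mathcal L^2$-type of $\bar a$ in $M_P$ equals the $\mathcal L^2$-type of $\bar a'$ in $M'_P$).
   Context: $T$ is a complete first-order theory in a language $\mathcal L$ and $\mathfrak C$ is a monster model of $T$; "small" means of cardinality smaller than the monstrosity of $\mathfrak C$ (its degree of saturation and strong homogeneity); tuples have small length. Juxtaposition denotes union, and tuples are identified with their sets of entries. An independence relation on $\mathfrak C$ is a ternary relation $A\downarrow_C B$ on small subsets of $\mathfrak C$ such that for all small $A,B,C,D$: (Invariance) $A\downarrow_B C\Rightarrow\sigma(A)\downarrow_{\sigma(B)}\sigma(C)$ for $\sigma\in\mathrm{Aut}(\mathfrak C)$; (Normality) $A\downarrow_C B\Rightarrow AC\downarrow_C B$; (Symmetry) $A\downarrow_B C\Rightarrow C\downarrow_B A$; (Transitivity) if $B\subseteq C\subseteq D$, then $A\downarrow_B D$ iff $A\downarrow_B C$ and $A\downarrow_C D$; (Finite character) $A\downarrow_B C$ iff $A_0\downarrow_B C$ for all finite $A_0\subseteq A$; (Extension) there is $A'\equiv_B A$ with $A'\downarrow_B C$; (Local character) there is a small cardinal $\lambda$ depending only on $\downarrow$ such that for all small $A,C$ there is $C_0\subseteq C$ with $|C_0|<\lambda+|A|^+$ and $A\downarrow_{C_0}C$.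 For arbitrary $A,B,C\subseteq\mathfrak C$, $A\downarrow_B C$ means: for all small $A'\subseteq A$, $B'\subseteq B$, $C'\subseteq C$ there is a small $B''$ with $B'\subseteq B''\subseteq B$ and $A'\downarrow_{B''}C'$. Fix an independence relation $\downarrow$ on $\mathfrak C$. $\kappa_0$ is the least regular cardinal $\mu$ such that for every finite tuple $\bar a$ and small set $B$ there is $B_0\subseteq B$ with $|B_0|<\mu$ and $\bar a\downarrow_{B_0}B$. $\mathcal L^2=\mathcal L\cup\{P\}$ with $P$ a new unary predicate; $T^2$ is the theory of all expansions of $T$ to $\mathcal L^2$. A superscript 1 (resp. 2) on a model-theoretic notion refers to $\mathcal L$ (resp. $\mathcal L^2$). Models of $T$ are elementary substructures of $\mathfrak C$; a model of $T^2$ is written $M_P=\langle M,P(M)\rangle$, and $P(A)=P(M)\cap A$ for $A\subseteq M$. For a complete type $q$ over $A\supseteq B$, $q\downarrow_B A$ means $c\downarrow_B A$ for a realization $c$ of $q$ in $\mathfrak C$. Fix a small cardinal $\kappa>\max(\kappa_0,|T|)$ (the same for all lovely pairs considered); a set or tuple is very small if its cardinality is $<\kappa$. $M_P\models T^2$ is a ($\downarrow$-)lovely pair if: (1) $M$ is a small model of $T$; (2) (Density property) for every very small $A\subset M$ and $q\in S^1_1(A)$ with $q\downarrow_{P(A)}A$, $q$ is realized in $P(M)$; (3) (Extension property) for every very small $A\subset M$ and $q\in S^1_1(A)$ there is $b\in M$ realizing $q$ with $b\downarrow_A P(M)$. A set (or tuple) $A\subseteq M$ is P-independent if $A\downarrow_{P(A)}P(M)$.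 The P-type of a possibly infinite tuple from $M$ is the information telling which of its members are in $P(M)$. *)

theory Defs
  imports Main
begin

unbundle cardinal_syntax

section \<open>First-order syntax and semantics\<close>

record ('f, 'r) lang =
  funs :: "'f set"
  rels :: "'r set"
  fun_arity :: "'f \<Rightarrow> nat"
  rel_arity :: "'r \<Rightarrow> nat"

datatype 'f trm = Var nat | App 'f "'f trm list"

datatype ('f, 'r) fm =
    Equal "'f trm" "'f trm"
  | Rel 'r "'f trm list"
  | Neg "('f, 'r) fm"
  | Conj "('f, 'r) fm" "('f, 'r) fm"
  | Exists nat "('f, 'r) fm"

fun trm_of_lang :: "('f, 'r) lang \<Rightarrow> 'f trm \<Rightarrow> bool" where
  "trm_of_lang L (Var n) \<longleftrightarrow> True"
| "trm_of_lang L (App f ts) \<longleftrightarrow>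
     f \<in> funs L \<and> length ts = fun_arity L f \<and> (\<forall>t \<in> set ts. trm_of_lang L t)"

fun fm_of_lang :: "('f, 'r) lang \<Rightarrow> ('f, 'r) fm \<Rightarrow> bool" where
  "fm_of_lang L (Equal s t) \<longleftrightarrow> trm_of_lang L s \<and> trm_of_lang L t"
| "fm_of_lang L (Rel r ts) \<longleftrightarrow>
     r \<in> rels L \<and> length ts = rel_arity L r \<and> (\<forall>t \<in> set ts. trm_of_lang L t)"
| "fm_of_lang L (Neg \<phi>) \<longleftrightarrow> fm_of_lang L \<phi>"
| "fm_of_lang L (Conj \<phi> \<psi>) \<longleftrightarrow> fm_of_lang L \<phi> \<and> fm_of_lang L \<psi>"
| "fm_of_lang L (Exists n \<phi>) \<longleftrightarrow> fm_of_lang L \<phi>"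

definition formulas :: "('f, 'r) lang \<Rightarrow> ('f, 'r) fm set" where
  "formulas L = {\<phi>. fm_of_lang L \<phi>}"

fun trm_vars :: "'f trm \<Rightarrow> nat set" where
  "trm_vars (Var n) = {n}"
| "trm_vars (App f ts) = (\<Union>t \<in> set ts. trm_vars t)"

fun free_vars :: "('f, 'r) fm \<Rightarrow> nat set" where
  "free_vars (Equal s t) = trm_vars s \<union> trm_vars t"
| "free_vars (Rel r ts) = (\<Union>t \<in> set ts. trm_vars t)"
| "free_vars (Neg \<phi>) = free_vars \<phi>"
| "free_vars (Conj \<phi> \<psi>) = free_vars \<phi> \<union> free_vars \<psi>"
| "free_vars (Exists n \<phi>) = free_vars \<phi> - {n}"

definition sentences :: "('f, 'r) lang \<Rightarrow> ('f, 'r) fm set" where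
  "sentences L = {\<phi> \<in> formulas L. free_vars \<phi> = {}}"

record ('f, 'r, 'a) struct =
  univ :: "'a set"
  fun_interp :: "'f \<Rightarrow> 'a list \<Rightarrow> 'a"
  rel_interp :: "'r \<Rightarrow> 'a list \<Rightarrow> bool"

definition closed_under_funs :: "('f, 'r) lang \<Rightarrow> ('f, 'r, 'a) struct \<Rightarrow> 'a set \<Rightarrow> bool" where
  "closed_under_funs L N A \<longleftrightarrow>
     (\<forall>f \<in> funs L. \<forall>xs. length xs = fun_arity L f \<and> set xs \<subseteq> A \<longrightarrow> fun_interp N f xs \<in> A)"

definition is_structure :: "('f, 'r) lang \<Rightarrow> ('f, 'r, 'a) struct \<Rightarrow> bool" where
  "is_structure L N \<longleftrightarrow> univ N \<noteq> {} \<and> closed_under_funs L N (univ N)"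

fun eval :: "('f, 'r, 'a) struct \<Rightarrow> (nat \<Rightarrow> 'a) \<Rightarrow> 'f trm \<Rightarrow> 'a" where
  "eval N e (Var n) = e n"
| "eval N e (App f ts) = fun_interp N f (map (eval N e) ts)"

fun sat :: "('f, 'r, 'a) struct \<Rightarrow> (nat \<Rightarrow> 'a) \<Rightarrow> ('f, 'r) fm \<Rightarrow> bool" where
  "sat N e (Equal s t) \<longleftrightarrow> eval N e s = eval N e t"
| "sat N e (Rel r ts) \<longleftrightarrow> rel_interp N r (map (eval N e) ts)"
| "sat N e (Neg \<phi>) \<longleftrightarrow> \<not> sat N e \<phi>"
| "sat N e (Conj \<phi> \<psi>) \<longleftrightarrow> sat N e \<phi> \<and> sat N e \<psi>"
| "sat N e (Exists n \<phi>) \<longleftrightarrow> (\<exists>d \<in> univ N. sat N (e(n := d)) \<phi>)"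

definition models :: "('f, 'r, 'a) struct \<Rightarrow> ('f, 'r) fm set \<Rightarrow> bool" where
  "models N T \<longleftrightarrow> (\<forall>\<phi> \<in> T. \<forall>e. sat N e \<phi>)"

text \<open>By the downward Loewenheim-Skolem theorem it does not restrict semantic consequence
  to consider only structures whose universe consists of formulas.\<close>

definition entails :: "('f, 'r) lang \<Rightarrow> ('f, 'r) fm set \<Rightarrow> ('f, 'r) fm \<Rightarrow> bool" where
  "entails L T \<phi> \<longleftrightarrow>
     (\<forall>N :: ('f, 'r, ('f, 'r) fm) struct. is_structure L N \<and> models N T \<longrightarrow> models N {\<phi>})"

text \<open>``Exactly one of'', so that a complete theory is consistent.\<close>

definition complete_theory :: "('f, 'r) lang \<Rightarrow> ('f, 'r) fm set \<Rightarrow> bool" where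
  "complete_theory L T \<longleftrightarrow>
     T \<subseteq> sentences L \<and> (\<forall>\<phi> \<in> sentences L. entails L T \<phi> \<noteq> entails L T (Neg \<phi>))"

section \<open>Types\<close>

text \<open>An \<open>L(B)\<close>-formula in variables \<open>x\<^sub>i\<close>, \<open>i \<in> I\<close>, is represented by an \<open>L\<close>-formula
  \<open>\<phi>\<close> together with a substitution \<open>s\<close> of its free variables by variables \<open>x\<^sub>i\<close>
  (written \<open>Inl i\<close>) and parameters \<open>b \<in> B\<close> (written \<open>Inr b\<close>). The values of \<open>s\<close> outside
  \<open>free_vars \<phi>\<close> are irrelevant. The index set \<open>I\<close> may be infinite.\<close>

definition formulas_over ::
  "('f, 'r) lang \<Rightarrow> 'i set \<Rightarrow> 'a set \<Rightarrow> (('f, 'r) fm \<times> (nat \<Rightarrow> 'i + 'a)) set" where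
  "formulas_over L I B =
     {(\<phi>, s). \<phi> \<in> formulas L \<and> s ` free_vars \<phi> \<subseteq> Inl ` I \<union> Inr ` B}"

definition holds ::
  "('f, 'r, 'a) struct \<Rightarrow> ('i \<Rightarrow> 'a) \<Rightarrow> ('f, 'r) fm \<times> (nat \<Rightarrow> 'i + 'a) \<Rightarrow> bool" where
  "holds N a = (\<lambda>(\<phi>, s). sat N (\<lambda>n. case s n of Inl i \<Rightarrow> a i | Inr b \<Rightarrow> b) \<phi>)"

text \<open>The type over \<open>B\<close>, in \<open>N\<close>, of the tuple \<open>a\<close> indexed by \<open>I\<close>.\<close>

definition tp ::
  "('f, 'r) lang \<Rightarrow> ('f, 'r, 'a) struct \<Rightarrow> 'a set \<Rightarrow> 'i set \<Rightarrow> ('i \<Rightarrow> 'a)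
    \<Rightarrow> (('f, 'r) fm \<times> (nat \<Rightarrow> 'i + 'a)) set" where
  "tp L N B I a = {\<psi> \<in> formulas_over L I B. holds N a \<psi>}"

type_synonym ('f, 'r, 'a) type1 = "(('f, 'r) fm \<times> (nat \<Rightarrow> unit + 'a)) set"

definition realizes :: "('f, 'r, 'a) struct \<Rightarrow> 'a \<Rightarrow> ('f, 'r, 'a) type1 \<Rightarrow> bool" where
  "realizes N c q \<longleftrightarrow> (\<forall>\<psi> \<in> q. holds N (\<lambda>_. c) \<psi>)"

text \<open>Complete types in one variable: complete sets of \<open>L(A)\<close>-formulas that are finitely
  satisfiable in \<open>N\<close>.\<close>

definition complete_types1 ::
  "('f, 'r) lang \<Rightarrow> ('f, 'r, 'a) struct \<Rightarrow> 'a set \<Rightarrow> ('f, 'r, 'a) type1 set" where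
  "complete_types1 L N A =
     {q. q \<subseteq> formulas_over L UNIV A
       \<and> (\<forall>q0 \<subseteq> q. finite q0 \<longrightarrow> (\<exists>c \<in> univ N. realizes N c q0))
       \<and> (\<forall>(\<phi>, s) \<in> formulas_over L UNIV A. (\<phi>, s) \<in> q \<or> (Neg \<phi>, s) \<in> q)}"

section \<open>Monster models\<close>

definition automorphism :: "('f, 'r) lang \<Rightarrow> ('f, 'r, 'a) struct \<Rightarrow> ('a \<Rightarrow> 'a) \<Rightarrow> bool" where
  "automorphism L N \<sigma> \<longleftrightarrow>
     bij_betw \<sigma> (univ N) (univ N)
     \<and> (\<forall>f \<in> funs L. \<forall>xs. length xs = fun_arity L f \<and> set xs \<subseteq> univ N
          \<longrightarrow> \<sigma> (fun_interp N f xs) = fun_interp N f (map \<sigma> xs))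
     \<and> (\<forall>r \<in> rels L. \<forall>xs. length xs = rel_arity L r \<and> set xs \<subseteq> univ N
          \<longrightarrow> rel_interp N r xs = rel_interp N r (map \<sigma> xs))"

definition small :: "('f, 'r, 'a) struct \<Rightarrow> 'k rel \<Rightarrow> 'a set \<Rightarrow> bool" where
  "small N \<mu> A \<longleftrightarrow> A \<subseteq> univ N \<and> |A| <o \<mu>"

definition saturated :: "('f, 'r) lang \<Rightarrow> ('f, 'r, 'a) struct \<Rightarrow> 'k rel \<Rightarrow> bool" where
  "saturated L N \<mu> \<longleftrightarrow>
     (\<forall>A. small N \<mu> A \<longrightarrow> (\<forall>q \<in> complete_types1 L N A. \<exists>c \<in> univ N. realizes N c q))"

text \<open>The function \<open>f\<close> restricted to \<open>A\<close> is a partial elementary map: the tuple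
  \<open>(f x)\<close>, \<open>x \<in> A\<close>, has the same type as the enumeration of \<open>A\<close> by itself.\<close>

definition strongly_homogeneous :: "('f, 'r) lang \<Rightarrow> ('f, 'r, 'a) struct \<Rightarrow> 'k rel \<Rightarrow> bool" where
  "strongly_homogeneous L N \<mu> \<longleftrightarrow>
     (\<forall>A f. small N \<mu> A \<and> f ` A \<subseteq> univ N \<and> tp L N {} A f = tp L N {} A (\<lambda>x. x)
        \<longrightarrow> (\<exists>\<sigma>. automorphism L N \<sigma> \<and> (\<forall>x \<in> A. \<sigma> x = f x)))"

text \<open>The cardinal \<open>\<mu>\<close> is the monstrosity of \<open>N\<close>.\<close>

definition monster_model ::
  "('f, 'r) lang \<Rightarrow> ('f, 'r) fm set \<Rightarrow> ('f, 'r, 'a) struct \<Rightarrow> 'k rel \<Rightarrow> bool" where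
  "monster_model L T N \<mu> \<longleftrightarrow>
     is_structure L N \<and> models N T \<and> Card_order \<mu> \<and> saturated L N \<mu> \<and> strongly_homogeneous L N \<mu>"

definition elementary_substructure ::
  "('f, 'r) lang \<Rightarrow> ('f, 'r, 'a) struct \<Rightarrow> 'a set \<Rightarrow> bool" where
  "elementary_substructure L N M \<longleftrightarrow>
     M \<subseteq> univ N \<and> M \<noteq> {} \<and> closed_under_funs L N M
     \<and> (\<forall>\<phi> \<in> formulas L. \<forall>e. e ` free_vars \<phi> \<subseteq> M
          \<longrightarrow> sat (N\<lparr>univ := M\<rparr>) e \<phi> = sat N e \<phi>)"

section \<open>Independence relations\<close>

text \<open>Throughout, \<open>ind A C B\<close> reads ``\<open>A\<close> is independent from \<open>B\<close> over \<open>C\<close>'': the base is the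
  middle argument. The axioms concern only small sets; the values of \<open>ind\<close> on other sets are
  irrelevant. In the extension axiom, \<open>A'\<close> is enumerated by \<open>A\<close> via \<open>f\<close>. In the local character
  axiom, every small cardinal is represented by a cardinal order on the type that carries \<open>\<mu>\<close>.\<close>

definition independence_relation ::
  "('f, 'r) lang \<Rightarrow> ('f, 'r, 'a) struct \<Rightarrow> 'k rel \<Rightarrow> ('a set \<Rightarrow> 'a set \<Rightarrow> 'a set \<Rightarrow> bool) \<Rightarrow> bool" where
  "independence_relation L N \<mu> ind \<longleftrightarrow>
     \<comment> \<open>invariance\<close>
     (\<forall>A B C \<sigma>. small N \<mu> A \<and> small N \<mu> B \<and> small N \<mu> C \<and> automorphism L N \<sigma> \<and> ind A B C
        \<longrightarrow> ind (\<sigma> ` A) (\<sigma> ` B) (\<sigma> ` C))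
     \<comment> \<open>normality\<close>
     \<and> (\<forall>A B C. small N \<mu> A \<and> small N \<mu> B \<and> small N \<mu> C \<and> ind A C B \<longrightarrow> ind (A \<union> C) C B)
     \<comment> \<open>symmetry\<close>
     \<and> (\<forall>A B C. small N \<mu> A \<and> small N \<mu> B \<and> small N \<mu> C \<and> ind A B C \<longrightarrow> ind C B A)
     \<comment> \<open>transitivity\<close>
     \<and> (\<forall>A B C D. small N \<mu> A \<and> small N \<mu> B \<and> small N \<mu> C \<and> small N \<mu> D \<and> B \<subseteq> C \<and> C \<subseteq> D
          \<longrightarrow> (ind A B D \<longleftrightarrow> ind A B C \<and> ind A C D))
     \<comment> \<open>finite character\<close>
     \<and> (\<forall>A B C. small N \<mu> A \<and> small N \<mu> B \<and> small N \<mu> C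
          \<longrightarrow> (ind A B C \<longleftrightarrow> (\<forall>A0 \<subseteq> A. finite A0 \<longrightarrow> ind A0 B C)))
     \<comment> \<open>extension\<close>
     \<and> (\<forall>A B C. small N \<mu> A \<and> small N \<mu> B \<and> small N \<mu> C
          \<longrightarrow> (\<exists>f. f ` A \<subseteq> univ N \<and> tp L N B A f = tp L N B A (\<lambda>x. x) \<and> ind (f ` A) B C))
     \<comment> \<open>local character\<close>
     \<and> (\<exists>l :: 'k rel. Card_order l \<and> l <o \<mu>
          \<and> (\<forall>A C. small N \<mu> A \<and> small N \<mu> C
               \<longrightarrow> (\<exists>C0 \<subseteq> C. |C0| <o l +c cardSuc |A| \<and> ind A C0 C)))"

definition local_character_bound ::
  "('f, 'r, 'a) struct \<Rightarrow> 'k rel \<Rightarrow> ('a set \<Rightarrow> 'a set \<Rightarrow> 'a set \<Rightarrow> bool) \<Rightarrow> 'k rel \<Rightarrow> bool" where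
  "local_character_bound N \<mu> ind \<nu> \<longleftrightarrow>
     Card_order \<nu> \<and> cinfinite \<nu> \<and> regularCard \<nu>
     \<and> (\<forall>A B. finite A \<and> A \<subseteq> univ N \<and> small N \<mu> B \<longrightarrow> (\<exists>B0 \<subseteq> B. |B0| <o \<nu> \<and> ind A B0 B))"

text \<open>The least such cardinal. Local character yields one that is at most \<open>\<mu>\<close>, so minimality
  among cardinals carried by the type of \<open>\<mu>\<close> is minimality among all cardinals.\<close>

definition is_kappa0 ::
  "('f, 'r, 'a) struct \<Rightarrow> 'k rel \<Rightarrow> ('a set \<Rightarrow> 'a set \<Rightarrow> 'a set \<Rightarrow> bool) \<Rightarrow> 'k rel \<Rightarrow> bool" where
  "is_kappa0 N \<mu> ind \<kappa>\<^sub>0 \<longleftrightarrow>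
     local_character_bound N \<mu> ind \<kappa>\<^sub>0
     \<and> (\<forall>\<nu> :: 'k rel. local_character_bound N \<mu> ind \<nu> \<longrightarrow> \<kappa>\<^sub>0 \<le>o \<nu>)"

section \<open>Lovely pairs\<close>

text \<open>The new predicate is \<open>None\<close>.\<close>

definition lang2 :: "('f, 'r) lang \<Rightarrow> ('f, 'r option) lang" where
  "lang2 L = \<lparr>funs = funs L, rels = insert None (Some ` rels L), fun_arity = fun_arity L,
     rel_arity = case_option 1 (rel_arity L)\<rparr>"

definition pair_struct ::
  "('f, 'r, 'a) struct \<Rightarrow> 'a set \<Rightarrow> 'a set \<Rightarrow> ('f, 'r option, 'a) struct" where
  "pair_struct N M P = \<lparr>univ = M, fun_interp = fun_interp N,
     rel_interp = case_option (\<lambda>xs. hd xs \<in> P) (rel_interp N)\<rparr>"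

text \<open>By invariance and strong homogeneity it does not matter which realization is taken.\<close>

definition type_ind ::
  "('f, 'r, 'a) struct \<Rightarrow> ('a set \<Rightarrow> 'a set \<Rightarrow> 'a set \<Rightarrow> bool) \<Rightarrow> ('f, 'r, 'a) type1
    \<Rightarrow> 'a set \<Rightarrow> 'a set \<Rightarrow> bool" where
  "type_ind N ind q B A \<longleftrightarrow> (\<exists>c \<in> univ N. realizes N c q \<and> ind {c} B A)"

text \<open>The pair is \<open>(M, P)\<close>, inside the monster model \<open>N\<close> of monstrosity \<open>\<mu>\<close>; sets of cardinality
  less than \<open>\<kappa>\<close> are very small. As \<open>M\<close> is an elementary substructure of \<open>N\<close>, types over
  subsets of \<open>M\<close> and their realizations in \<open>M\<close> may be computed in \<open>N\<close>.\<close>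

definition lovely_pair ::
  "('f, 'r) lang \<Rightarrow> ('f, 'r, 'a) struct \<Rightarrow> 'k rel \<Rightarrow> ('a set \<Rightarrow> 'a set \<Rightarrow> 'a set \<Rightarrow> bool) \<Rightarrow> 'k rel
    \<Rightarrow> 'a set \<Rightarrow> 'a set \<Rightarrow> bool" where
  "lovely_pair L N \<mu> ind \<kappa> M P \<longleftrightarrow>
     P \<subseteq> M \<and> small N \<mu> M \<and> elementary_substructure L N M
     \<comment> \<open>density property\<close>
     \<and> (\<forall>A q. A \<subseteq> M \<and> |A| <o \<kappa> \<and> q \<in> complete_types1 L N A \<and> type_ind N ind q (P \<inter> A) A
          \<longrightarrow> (\<exists>b \<in> P. realizes N b q))
     \<comment> \<open>extension property\<close>
     \<and> (\<forall>A q. A \<subseteq> M \<and> |A| <o \<kappa> \<and> q \<in> complete_types1 L N A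
          \<longrightarrow> (\<exists>b \<in> M. realizes N b q \<and> ind {b} A P))"

definition P_independent ::
  "('a set \<Rightarrow> 'a set \<Rightarrow> 'a set \<Rightarrow> bool) \<Rightarrow> 'a set \<Rightarrow> 'a set \<Rightarrow> bool" where
  "P_independent ind P A \<longleftrightarrow> ind A (P \<inter> A) P"

end

theory Submission
  imports Defs
begin

text \<open>The proof is a back-and-forth argument between the two pairs. A position of the game is a
  very small partial elementary map between \<open>M\<close> and \<open>M'\<close> that respects the predicates and whose
  domain and range are P-independent; such a map can be extended to any further element of \<open>M\<close>
  (\<open>forth\<close>), and by symmetry its inverse can be extended to any further element of \<open>M'\<close>.
  Hence all \<open>\<L>\<^sup>2\<close>-formulas are preserved (\<open>back_and_forth_sat\<close>), by induction on the formula.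

  Let \<open>A \<rightarrow> A'\<close> be a position and let \<open>b \<in> M\<close>. If \<open>b \<in> P\<close>, then P-independence makes \<open>b\<close>
  independent from \<open>A\<close> over \<open>P(A)\<close>, so that the density property of \<open>M'\<close> gives an image of \<open>b\<close>
  in \<open>P'\<close>, and P-independence survives because elements of the predicate may always be added to a
  P-independent set. If \<open>b \<notin> P\<close>, local character gives a very small \<open>C \<subseteq> P\<close> such that \<open>A b\<close>
  is independent from \<open>P\<close> over \<open>C\<close>. By the first case, iterated with Zorn's lemma, \<open>C\<close> may be
  assumed to lie in \<open>A\<close>; then \<open>A b\<close> is P-independent. The extension property of \<open>M'\<close> gives \<open>b'\<close>
  with the right type over \<open>A'\<close> and independent from \<open>P'\<close> over \<open>A'\<close>, whence \<open>A' b'\<close> is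
  independent from \<open>P'\<close> over \<open>P'(A')\<close>.

  It remains to see that \<open>b' \<notin> P'\<close>. Otherwise \<open>b'\<close> would be independent from itself over
  \<open>P'(A')\<close>, and so, by invariance, \<open>b\<close> would be independent from itself over \<open>P(A)\<close>. No
  anti-reflexivity of the independence relation is needed to refute this: the density property,
  applied to the type that says \<open>x = b\<close>, puts \<open>b\<close> into \<open>P\<close> (\<open>self_ind_in_P\<close>).\<close>

section \<open>Automorphisms and partial elementary maps\<close>

lemma eval_cong: "(\<And>n. n \<in> trm_vars t \<Longrightarrow> e n = e' n) \<Longrightarrow> eval N e t = eval N e' t"
proof (induction t)
  case (App f ts)
  have "map (eval N e) ts = map (eval N e') ts"
    by (rule map_cong[OF refl]) (auto intro!: App.IH App.prems)
  then show ?case by (simp only: eval.simps)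
qed simp

lemma sat_cong: "(\<And>n. n \<in> free_vars \<phi> \<Longrightarrow> e n = e' n) \<Longrightarrow> sat N e \<phi> = sat N e' \<phi>"
proof (induction \<phi> arbitrary: e e')
  case (Equal s t)
  then show ?case using eval_cong[of s e e' N] eval_cong[of t e e' N] by auto
next
  case (Rel r ts)
  have "map (eval N e) ts = map (eval N e') ts" using Rel by (auto intro!: eval_cong)
  then show ?case by (simp only: sat.simps)
next
  case (Neg \<phi>)
  then show ?case by (metis free_vars.simps(3) sat.simps(3))
next
  case (Conj \<phi> \<psi>)
  have "sat N e \<phi> = sat N e' \<phi>" "sat N e \<psi> = sat N e' \<psi>"
    by (rule Conj.IH; simp add: Conj.prems)+
  then show ?case by simp
next
  case (Exists n \<phi>)
  have "sat N (e(n := d)) \<phi> = sat N (e'(n := d)) \<phi>" for d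
    by (rule Exists.IH) (simp add: Exists.prems)
  then show ?case by simp
qed

lemma finite_trm_vars: "finite (trm_vars t)"
  by (induction t) auto

lemma finite_free_vars: "finite (free_vars \<phi>)"
  by (induction \<phi>) (auto simp: finite_trm_vars)

lemma eval_closed:
  assumes "closed_under_funs L N A"
  shows "trm_of_lang L t \<Longrightarrow> e ` trm_vars t \<subseteq> A \<Longrightarrow> eval N e t \<in> A"
proof (induction t)
  case (App f ts)
  then have "set (map (eval N e) ts) \<subseteq> A" by fastforce
  then show ?case using assms App.prems unfolding closed_under_funs_def by simp
qed auto

lemma automorphism_eval:
  assumes "is_structure L N" and "automorphism L N \<sigma>"
  shows "trm_of_lang L t \<Longrightarrow> e ` trm_vars t \<subseteq> univ N \<Longrightarrow> eval N (\<sigma> \<circ> e) t = \<sigma> (eval N e t)"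
proof (induction t)
  case (App f ts)
  have cl: "closed_under_funs L N (univ N)" using assms(1) by (simp add: is_structure_def)
  have *: "map (eval N (\<sigma> \<circ> e)) ts = map \<sigma> (map (eval N e) ts)"
    using App by (fastforce intro!: App.IH)
  have "set (map (eval N e) ts) \<subseteq> univ N"
    using App.prems by (fastforce intro!: eval_closed[OF cl])
  then have "\<sigma> (fun_interp N f (map (eval N e) ts)) = fun_interp N f (map \<sigma> (map (eval N e) ts))"
    using assms(2) App.prems unfolding automorphism_def by simp
  then show ?case using * by (simp only: eval.simps)
qed simp

lemma automorphism_sat:
  assumes "is_structure L N" and "automorphism L N \<sigma>"
  shows "fm_of_lang L \<phi> \<Longrightarrow> e ` free_vars \<phi> \<subseteq> univ N \<Longrightarrow> sat N (\<sigma> \<circ> e) \<phi> = sat N e \<phi>"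
proof (induction \<phi> arbitrary: e)
  case (Equal s t)
  have cl: "closed_under_funs L N (univ N)" using assms(1) by (simp add: is_structure_def)
  have "eval N e s \<in> univ N" "eval N e t \<in> univ N"
    using Equal by (auto intro!: eval_closed[OF cl])
  moreover have "eval N (\<sigma> \<circ> e) s = \<sigma> (eval N e s)" "eval N (\<sigma> \<circ> e) t = \<sigma> (eval N e t)"
    using Equal by (auto intro!: automorphism_eval[OF assms])
  moreover have "inj_on \<sigma> (univ N)"
    using assms(2) by (simp add: automorphism_def bij_betw_def)
  ultimately show ?case by (simp only: sat.simps inj_on_eq_iff)
next
  case (Rel r ts)
  have cl: "closed_under_funs L N (univ N)" using assms(1) by (simp add: is_structure_def)
  have *: "map (eval N (\<sigma> \<circ> e)) ts = map \<sigma> (map (eval N e) ts)"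
    using Rel by (fastforce intro!: automorphism_eval[OF assms])
  have "set (map (eval N e) ts) \<subseteq> univ N"
    using Rel.prems by (fastforce intro!: eval_closed[OF cl])
  then have "rel_interp N r (map (eval N e) ts) = rel_interp N r (map \<sigma> (map (eval N e) ts))"
    using assms(2) Rel.prems unfolding automorphism_def by simp
  then show ?case using * by (simp only: sat.simps)
next
  case (Neg \<phi>)
  then show ?case by simp
next
  case (Conj \<phi> \<psi>)
  then show ?case by (simp add: image_Un)
next
  case (Exists n \<phi>)
  have im: "\<sigma> ` univ N = univ N"
    using assms(2) by (simp add: automorphism_def bij_betw_def)
  have *: "sat N ((\<sigma> \<circ> e)(n := \<sigma> d)) \<phi> = sat N (e(n := d)) \<phi>" if "d \<in> univ N" for d
  proof -
    have "(\<sigma> \<circ> e)(n := \<sigma> d) = \<sigma> \<circ> e(n := d)" by auto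
    moreover have "e(n := d) ` free_vars \<phi> \<subseteq> univ N" using Exists.prems that by auto
    ultimately show ?thesis using Exists.IH[of "e(n := d)"] Exists.prems(1)
      by (simp only: fm_of_lang.simps)
  qed
  have "(\<exists>d\<in>univ N. sat N ((\<sigma> \<circ> e)(n := d)) \<phi>)
      \<longleftrightarrow> (\<exists>d\<in>univ N. sat N ((\<sigma> \<circ> e)(n := \<sigma> d)) \<phi>)"
    by (subst im[symmetric]) blast
  also have "\<dots> \<longleftrightarrow> (\<exists>d\<in>univ N. sat N (e(n := d)) \<phi>)" using * by blast
  finally show ?case by (simp only: sat.simps)
qed

text \<open>A partial elementary map, given by its graph. Graphs make the notion symmetric under
  converse; that they are graphs of injective functions is a consequence.\<close>

definition elementary_rel ::
  "('f, 'r) lang \<Rightarrow> ('f, 'r, 'a) struct \<Rightarrow> ('a \<times> 'a) set \<Rightarrow> bool" where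
  "elementary_rel L N R \<longleftrightarrow>
     (\<forall>\<phi> \<in> formulas L. \<forall>e. e ` free_vars \<phi> \<subseteq> R \<longrightarrow> sat N (fst \<circ> e) \<phi> = sat N (snd \<circ> e) \<phi>)"

lemma elementary_relD:
  "elementary_rel L N R \<Longrightarrow> fm_of_lang L \<phi> \<Longrightarrow> e ` free_vars \<phi> \<subseteq> R
    \<Longrightarrow> sat N (fst \<circ> e) \<phi> = sat N (snd \<circ> e) \<phi>"
  by (simp add: elementary_rel_def formulas_def)

lemma elementary_rel_converse:
  assumes "elementary_rel L N R"
  shows "elementary_rel L N (R\<inverse>)"
  unfolding elementary_rel_def
proof (intro ballI allI impI)
  fix \<phi> and e :: "nat \<Rightarrow> _"
  assume "\<phi> \<in> formulas L" and "e ` free_vars \<phi> \<subseteq> R\<inverse>"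
  then have "(prod.swap \<circ> e) ` free_vars \<phi> \<subseteq> R" "fm_of_lang L \<phi>"
    by (auto simp: formulas_def image_subset_iff prod.swap_def)
  from elementary_relD[OF assms this(2,1)]
  show "sat N (fst \<circ> e) \<phi> = sat N (snd \<circ> e) \<phi>"
    by (simp add: comp_def)
qed

lemma elementary_rel_eq_iff:
  assumes "elementary_rel L N R" and "(x, y) \<in> R" and "(x', y') \<in> R"
  shows "x = x' \<longleftrightarrow> y = y'"
  using elementary_relD[OF assms(1), of "Equal (Var 0) (Var (Suc 0))"
      "\<lambda>n. if n = 0 then (x, y) else (x', y')"] assms(2,3) by auto

lemma elementary_rel_Union_chain:
  assumes "subset.chain \<A> \<C>" and "\<C> \<noteq> {}" and "\<And>R. R \<in> \<C> \<Longrightarrow> elementary_rel L N R"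
  shows "elementary_rel L N (\<Union>\<C>)"
  unfolding elementary_rel_def
proof (intro ballI allI impI)
  fix \<phi> and e :: "nat \<Rightarrow> _"
  assume \<phi>: "\<phi> \<in> formulas L" and e: "e ` free_vars \<phi> \<subseteq> \<Union>\<C>"
  have "finite (e ` free_vars \<phi>)" by (simp add: finite_free_vars)
  then obtain R where "R \<in> \<C>" "e ` free_vars \<phi> \<subseteq> R"
    using finite_subset_Union_chain[OF _ e assms(2,1)] by blast
  then show "sat N (fst \<circ> e) \<phi> = sat N (snd \<circ> e) \<phi>"
    using assms(3) \<phi> unfolding elementary_rel_def by blast
qed

lemma tp_in_complete_types1:
  fixes N :: "('f, 'r, 'a) struct"
  assumes "c \<in> univ N"
  shows "tp L N A UNIV (\<lambda>_. c) \<in> complete_types1 L N A"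
proof -
  let ?q = "tp L N A UNIV (\<lambda>_. c) :: ('f, 'r, 'a) type1"
  have "\<exists>x \<in> univ N. realizes N x q0" if "q0 \<subseteq> ?q" for q0
    using assms that unfolding realizes_def tp_def by blast
  moreover have "(\<phi>, s) \<in> ?q \<or> (Neg \<phi>, s) \<in> ?q" if "(\<phi>, s) \<in> formulas_over L UNIV A" for \<phi> s
    using that by (simp add: tp_def formulas_over_def formulas_def holds_def)
  moreover have "?q \<subseteq> formulas_over L UNIV A" by (auto simp: tp_def)
  ultimately show ?thesis unfolding complete_types1_def by blast
qed

lemma realizes_tpD:
  fixes s :: "nat \<Rightarrow> unit + _"
  assumes "realizes N b (tp L N A UNIV (\<lambda>_. c))" and "(\<phi>, s) \<in> formulas_over L UNIV A"
  shows "holds N (\<lambda>_. b) (\<phi>, s) = holds N (\<lambda>_. c) (\<phi>, s)"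
proof -
  have "(Neg \<phi>, s) \<in> formulas_over L UNIV A"
    using assms(2) by (auto simp: formulas_over_def formulas_def)
  moreover have "holds N x (Neg \<phi>, s) \<longleftrightarrow> \<not> holds N x (\<phi>, s)" for x by (simp add: holds_def)
  ultimately show ?thesis using assms unfolding realizes_def tp_def by blast
qed

lemma realizes_tp_member_eq:
  assumes "realizes N b (tp L N A UNIV (\<lambda>_. c))" and "c \<in> A"
  shows "b = c"
proof -
  let ?s = "\<lambda>n::nat. if n = 0 then Inl () else Inr c"
  have "(Equal (Var 0) (Var (Suc 0)), ?s) \<in> formulas_over L UNIV A"
    using assms(2) by (auto simp: formulas_over_def formulas_def)
  from realizes_tpD[OF assms(1) this] show ?thesis by (simp add: holds_def)
qed

text \<open>If \<open>\<sigma>\<close> is an automorphism that extends a partial elementary map, the map may send a new element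
  \<open>b\<close> to any realization of the type of \<open>\<sigma> b\<close> over its range.\<close>

lemma elementary_rel_insert:
  assumes str: "is_structure L N" and aut: "automorphism L N \<sigma>" and R: "R \<subseteq> univ N \<times> univ N"
    and \<sigma>: "\<And>x y. (x, y) \<in> R \<Longrightarrow> \<sigma> x = y" and b: "b \<in> univ N"
    and b': "realizes N b' (tp L N (Range R) UNIV (\<lambda>_. \<sigma> b))"
  shows "elementary_rel L N (insert (b, b') R)"
  unfolding elementary_rel_def
proof (intro ballI allI impI)
  fix \<phi> and e :: "nat \<Rightarrow> _"
  assume \<phi>: "\<phi> \<in> formulas L" and e: "e ` free_vars \<phi> \<subseteq> insert (b, b') R"
  \<comment> \<open>Elements of the range of the old map become parameters, the new element the variable.\<close>
  let ?s = "\<lambda>n. if e n \<in> R then Inr (snd (e n)) else Inl ()"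
  have s: "(\<phi>, ?s) \<in> formulas_over L UNIV (Range R)"
  proof -
    have "?s n \<in> Inl ` UNIV \<union> Inr ` Range R" for n by (force simp: Range_snd)
    then show ?thesis using \<phi> unfolding formulas_over_def by blast
  qed
  have "sat N (fst \<circ> e) \<phi> = sat N (\<sigma> \<circ> (fst \<circ> e)) \<phi>"
  proof (rule automorphism_sat[OF str aut, symmetric])
    show "fm_of_lang L \<phi>" using \<phi> by (simp add: formulas_def)
    show "(fst \<circ> e) ` free_vars \<phi> \<subseteq> univ N" using e R b by fastforce
  qed
  also have "\<dots> = holds N (\<lambda>_. \<sigma> b) (\<phi>, ?s)"
    unfolding holds_def prod.case
  proof (rule sat_cong)
    fix n assume "n \<in> free_vars \<phi>"
    then have "e n \<in> insert (b, b') R" using e by blast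
    then show "(\<sigma> \<circ> (fst \<circ> e)) n = (case ?s n of Inl i \<Rightarrow> \<sigma> b | Inr b \<Rightarrow> b)"
      using \<sigma>[of "fst (e n)" "snd (e n)"] by auto
  qed
  also have "\<dots> = holds N (\<lambda>_. b') (\<phi>, ?s)" using realizes_tpD[OF b' s] by simp
  also have "\<dots> = sat N (snd \<circ> e) \<phi>"
    unfolding holds_def prod.case
  proof (rule sat_cong)
    fix n assume "n \<in> free_vars \<phi>"
    then have "e n \<in> insert (b, b') R" using e by blast
    then show "(case ?s n of Inl i \<Rightarrow> b' | Inr b \<Rightarrow> b) = (snd \<circ> e) n" by auto
  qed
  finally show "sat N (fst \<circ> e) \<phi> = sat N (snd \<circ> e) \<phi>" .
qed

section \<open>Independence in the monster model\<close>

lemma card_of_Fpow_ordLeq: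
  assumes "infinite A"
  shows "|Fpow A| \<le>o |A|"
proof -
  have "|{F \<in> Fpow A. card F = n}| \<le>o |A|" for n
  proof (induction n)
    case 0
    have "{F \<in> Fpow A. card F = 0} = {{}}" by (auto simp: Fpow_def)
    then show ?case using card_of_singl_ordLeq[of A "{}"] assms by auto
  next
    case (Suc n)
    let ?S = "A \<times> {F \<in> Fpow A. card F = n}"
    have "{F \<in> Fpow A. card F = Suc n} \<subseteq> (\<lambda>(x, F). insert x F) ` ?S"
    proof
      fix F assume "F \<in> {F \<in> Fpow A. card F = Suc n}"
      then have F: "F \<subseteq> A" "finite F" "card F = Suc n" by (simp_all add: Fpow_def)
      then obtain x where x: "x \<in> F" by fastforce
      have "F = (\<lambda>(x, F). insert x F) (x, F - {x})" using x by auto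
      moreover have "(x, F - {x}) \<in> ?S" using F x by (auto simp: Fpow_def)
      ultimately show "F \<in> (\<lambda>(x, F). insert x F) ` ?S" by (rule image_eqI)
    qed
    then have "|{F \<in> Fpow A. card F = Suc n}| \<le>o |?S|" by (rule surj_imp_ordLeq)
    moreover have "|?S| \<le>o |A|"
      by (rule card_of_Sigma_ordLeq_infinite[OF assms]) (simp_all add: Suc card_of_mono1)
    ultimately show ?case by (rule ordLeq_transitive)
  qed
  moreover have "|UNIV :: nat set| \<le>o |A|" using assms infinite_iff_card_of_nat by blast
  ultimately have "|\<Union>n. {F \<in> Fpow A. card F = n}| \<le>o |A|"
    by (intro card_of_UNION_ordLeq_infinite[OF assms] ballI)
  moreover have "(\<Union>n. {F \<in> Fpow A. card F = n}) = Fpow A" by blast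
  ultimately show ?thesis by simp
qed

text \<open>A monster model \<open>N\<close> of monstrosity \<open>\<mu>\<close> with an independence relation for which \<open>\<kappa>\<^sub>0\<close> bounds
  the local character of finite sets; sets of cardinality less than \<open>\<kappa>\<close> are very small.\<close>

locale independence_setting =
  fixes L :: "('f, 'r) lang" and T :: "('f, 'r) fm set" and N :: "('f, 'r, 'a) struct"
    and \<mu> \<kappa>\<^sub>0 \<kappa> :: "'k rel" and ind :: "'a set \<Rightarrow> 'a set \<Rightarrow> 'a set \<Rightarrow> bool"
  assumes monster: "monster_model L T N \<mu>"
    and indep: "independence_relation L N \<mu> ind"
    and bound: "local_character_bound N \<mu> ind \<kappa>\<^sub>0"
    and Card_\<kappa>: "Card_order \<kappa>" and \<kappa>_less_\<mu>: "\<kappa> <o \<mu>" and \<kappa>\<^sub>0_less_\<kappa>: "\<kappa>\<^sub>0 <o \<kappa>"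
begin

lemma structure_N: "is_structure L N"
  using monster by (simp add: monster_model_def)

lemma Card_\<kappa>\<^sub>0: "Card_order \<kappa>\<^sub>0" and infinite_\<kappa>\<^sub>0: "infinite (Field \<kappa>\<^sub>0)"
  using bound by (auto simp: local_character_bound_def cinfinite_def)

lemma infinite_\<kappa>: "infinite (Field \<kappa>)"
  using cinfinite_mono[OF ordLess_imp_ordLeq[OF \<kappa>\<^sub>0_less_\<kappa>]] infinite_\<kappa>\<^sub>0 by (simp add: cinfinite_def)

lemma very_small_Un: "|A| <o \<kappa> \<Longrightarrow> |B| <o \<kappa> \<Longrightarrow> |A \<union> B| <o \<kappa>"
  by (rule card_of_Un_ordLess_infinite_Field[OF infinite_\<kappa> Card_\<kappa>])

lemma very_small_finite: "finite A \<Longrightarrow> |A| <o \<kappa>"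
  using finite_ordLess_infinite[OF card_of_Well_order card_order_on_well_order_on[OF Card_\<kappa>]]
    infinite_\<kappa> by (simp add: Field_card_of)

lemma very_small_insert: "|A| <o \<kappa> \<Longrightarrow> |insert x A| <o \<kappa>"
  using very_small_Un[of "{x}" A] very_small_finite[of "{x}"] by simp

lemma very_small_subset: "|B| <o \<kappa> \<Longrightarrow> A \<subseteq> B \<Longrightarrow> |A| <o \<kappa>"
  by (meson card_of_mono1 ordLeq_ordLess_trans)

lemma very_small_image: "|A| <o \<kappa> \<Longrightarrow> |f ` A| <o \<kappa>"
  by (rule ordLeq_ordLess_trans[OF card_of_image])

lemma very_small_Domain: "|R| <o \<kappa> \<Longrightarrow> |Domain R| <o \<kappa>"
  by (simp add: Domain_fst very_small_image)

lemma very_small_Range: "|R| <o \<kappa> \<Longrightarrow> |Range R| <o \<kappa>"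
  by (simp add: Range_snd very_small_image)

lemma very_small_converse:
  assumes "|R| <o \<kappa>"
  shows "|R\<inverse>| <o \<kappa>"
proof -
  have "R\<inverse> = prod.swap ` R" by force
  then show ?thesis using very_small_image[OF assms] by simp
qed

lemma small_if_very_small: "A \<subseteq> univ N \<Longrightarrow> |A| <o \<kappa> \<Longrightarrow> small N \<mu> A"
  using \<kappa>_less_\<mu> unfolding small_def by (meson ordLess_transitive)

lemma small_subset: "small N \<mu> B \<Longrightarrow> A \<subseteq> B \<Longrightarrow> small N \<mu> A"
  unfolding small_def by (meson card_of_mono1 ordLeq_ordLess_trans subset_trans)

lemma small_Un:
  assumes "small N \<mu> A" and "small N \<mu> B"
  shows "small N \<mu> (A \<union> B)"
proof -
  have \<mu>: "Card_order \<mu>" using monster by (simp add: monster_model_def)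
  have "infinite (Field \<mu>)"
    using cinfinite_mono[OF ordLess_imp_ordLeq[OF \<kappa>_less_\<mu>]] infinite_\<kappa> by (simp add: cinfinite_def)
  then show ?thesis
    using assms card_of_Un_ordLess_infinite_Field[OF _ \<mu>] unfolding small_def by blast
qed

lemmas ind_axioms = indep[unfolded independence_relation_def]

lemma ind_invariant:
  "small N \<mu> A \<Longrightarrow> small N \<mu> B \<Longrightarrow> small N \<mu> C \<Longrightarrow> automorphism L N \<sigma> \<Longrightarrow> ind A B C
    \<Longrightarrow> ind (\<sigma> ` A) (\<sigma> ` B) (\<sigma> ` C)"
  using ind_axioms[THEN conjunct1] by blast

lemma ind_normal:
  "small N \<mu> A \<Longrightarrow> small N \<mu> B \<Longrightarrow> small N \<mu> C \<Longrightarrow> ind A C B \<Longrightarrow> ind (A \<union> C) C B"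
  using ind_axioms[THEN conjunct2, THEN conjunct1] by blast

lemma ind_sym:
  "small N \<mu> A \<Longrightarrow> small N \<mu> B \<Longrightarrow> small N \<mu> C \<Longrightarrow> ind A B C \<Longrightarrow> ind C B A"
  using ind_axioms[THEN conjunct2, THEN conjunct2, THEN conjunct1] by blast

lemma ind_trans_iff:
  assumes "small N \<mu> A" "small N \<mu> D" "B \<subseteq> C" "C \<subseteq> D"
  shows "ind A B D \<longleftrightarrow> ind A B C \<and> ind A C D"
  using ind_axioms[THEN conjunct2, THEN conjunct2, THEN conjunct2, THEN conjunct1, rule_format, of A B C D]
    assms small_subset[of D C] small_subset[of D B] by blast

lemma ind_finite_char:
  "small N \<mu> A \<Longrightarrow> small N \<mu> B \<Longrightarrow> small N \<mu> C
    \<Longrightarrow> ind A B C \<longleftrightarrow> (\<forall>A0 \<subseteq> A. finite A0 \<longrightarrow> ind A0 B C)"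
  using ind_axioms[THEN conjunct2, THEN conjunct2, THEN conjunct2, THEN conjunct2, THEN conjunct1] by blast

lemma ind_mono_left:
  assumes "small N \<mu> A" "small N \<mu> B" "small N \<mu> C" "ind A B C" "A' \<subseteq> A"
  shows "ind A' B C"
  using assms ind_finite_char[of A B C] ind_finite_char[of A' B C] small_subset[of A A'] by blast

lemma ind_mono_right:
  assumes "small N \<mu> A" "small N \<mu> B" "small N \<mu> C" "ind A B C" "C' \<subseteq> C"
  shows "ind A B C'"
  using assms ind_mono_left[of C B A C'] ind_sym[of A B C] ind_sym[of C' B A]
    small_subset[of C C'] by blast

text \<open>The cardinal \<open>\<kappa>\<close> need not be regular; \<open>C\<close> is very small because there are at most
  \<open>\<lambda> + \<aleph>\<^sub>0\<close> finite subsets of a set of cardinality \<open>\<lambda> < \<kappa>\<close>, each of which needs a base of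
  cardinality less than \<open>\<kappa>\<^sub>0 < \<kappa>\<close>.\<close>

lemma very_small_base:
  assumes A: "A \<subseteq> univ N" "|A| <o \<kappa>" and B: "small N \<mu> B"
  obtains C where "C \<subseteq> B" and "|C| <o \<kappa>" and "ind A C B"
proof -
  have "\<exists>C \<subseteq> B. |C| <o \<kappa>\<^sub>0 \<and> ind F C B" if "F \<in> Fpow A" for F
    using bound[unfolded local_character_bound_def, THEN conjunct2, THEN conjunct2, THEN conjunct2,
        rule_format, of F B] that A(1) B by (auto simp: Fpow_def)
  then have "\<forall>F \<in> Fpow A. \<exists>C. C \<subseteq> B \<and> |C| <o \<kappa>\<^sub>0 \<and> ind F C B" by blast
  from bchoice[OF this] obtain c
    where c: "\<And>F. F \<in> Fpow A \<Longrightarrow> c F \<subseteq> B \<and> |c F| <o \<kappa>\<^sub>0 \<and> ind F (c F) B" by blast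
  define C where "C = (\<Union>F\<in>Fpow A. c F)"
  have CB: "C \<subseteq> B" using c by (auto simp: C_def)
  have Fpow: "|Fpow A| <o \<kappa>"
  proof (cases "finite A")
    case True
    then have "finite (Fpow A)" by (simp add: Fpow_def)
    then show ?thesis by (rule very_small_finite)
  next
    case False
    show ?thesis by (rule ordLeq_ordLess_trans[OF card_of_Fpow_ordLeq[OF False] A(2)])
  qed
  have "|C| <o \<kappa>"
  proof (cases "|Fpow A| \<le>o \<kappa>\<^sub>0")
    case True
    have "\<forall>F \<in> Fpow A. |c F| \<le>o \<kappa>\<^sub>0" using c by (auto intro: ordLess_imp_ordLeq)
    then have "|C| \<le>o \<kappa>\<^sub>0"
      unfolding C_def by (rule card_of_UNION_ordLeq_infinite_Field[OF infinite_\<kappa>\<^sub>0 Card_\<kappa>\<^sub>0 True])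
    then show ?thesis using \<kappa>\<^sub>0_less_\<kappa> by (rule ordLeq_ordLess_trans)
  next
    case False
    then have le: "\<kappa>\<^sub>0 \<le>o |Fpow A|"
      using ordLeq_total[OF card_of_Well_order card_order_on_well_order_on[OF Card_\<kappa>\<^sub>0]] by blast
    then have inf: "infinite (Fpow A)"
      using cinfinite_mono[OF le] infinite_\<kappa>\<^sub>0 by (simp add: cinfinite_def Field_card_of)
    have "|c F| \<le>o |Fpow A|" if "F \<in> Fpow A" for F
      by (rule ordLeq_transitive[OF ordLess_imp_ordLeq le]) (simp add: c[OF that])
    then have "|C| \<le>o |Fpow A|"
      unfolding C_def
      by (intro card_of_UNION_ordLeq_infinite[OF inf] card_of_mono1[OF subset_refl] ballI)
    then show ?thesis using Fpow by (rule ordLeq_ordLess_trans)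
  qed
  moreover have "ind A C B"
  proof -
    have "ind F C B" if F: "F \<subseteq> A" "finite F" for F
    proof -
      have FA: "F \<in> Fpow A" using F by (simp add: Fpow_def)
      have "small N \<mu> F" using F A by (intro small_if_very_small very_small_finite) auto
      moreover have "c F \<subseteq> C" using FA by (auto simp: C_def)
      ultimately show ?thesis using ind_trans_iff[OF _ B _ CB, of F "c F"] c[OF FA] by simp
    qed
    then show ?thesis
      using ind_finite_char[OF small_if_very_small[OF A] small_subset[OF B CB] B] by simp
  qed
  ultimately show ?thesis using that CB by simp
qed

text \<open>Elements of the predicate may always be added to a P-independent set.\<close>

lemma P_independent_Un:
  assumes A: "small N \<mu> A" and P: "small N \<mu> P" and "P_independent ind P A" and "C \<subseteq> P"
  shows "P_independent ind P (A \<union> C)"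
proof -
  let ?D = "P \<inter> (A \<union> C)"
  have D: "P \<inter> A \<subseteq> ?D" "?D \<subseteq> P" by auto
  have "ind A ?D P"
    using ind_trans_iff[OF A P D] assms(3) by (simp add: P_independent_def)
  then have "ind (A \<union> ?D) ?D P" by (rule ind_normal[OF A P small_subset[OF P D(2)]])
  moreover have "A \<union> P \<inter> (A \<union> C) = A \<union> C" using assms(4) by blast
  ultimately show ?thesis by (simp add: P_independent_def)
qed

lemma automorphism_extending:
  assumes el: "elementary_rel L N R" and R: "R \<subseteq> univ N \<times> univ N" and "|R| <o \<kappa>"
  obtains \<sigma> where "automorphism L N \<sigma>" and "\<And>x y. (x, y) \<in> R \<Longrightarrow> \<sigma> x = y"
proof -
  define f where "f x = (SOME y. (x, y) \<in> R)" for x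
  have f: "(x, f x) \<in> R" if "x \<in> Domain R" for x
    using that unfolding f_def by (metis DomainE someI)
  have f_eq: "f x = y" if "(x, y) \<in> R" for x y
    using elementary_rel_eq_iff[OF el that f] that by blast
  have "|Domain R| <o \<kappa>"
    using assms(3) by (rule very_small_Domain)
  then have "small N \<mu> (Domain R)" using R by (intro small_if_very_small) auto
  moreover have "f ` Domain R \<subseteq> univ N" using f R by blast
  moreover have "tp L N {} (Domain R) f = tp L N {} (Domain R) (\<lambda>x. x)"
  proof -
    have "holds N f (\<phi>, s) = holds N (\<lambda>x. x) (\<phi>, s)"
      if "(\<phi>, s) \<in> formulas_over L (Domain R) {}" for \<phi> and s :: "nat \<Rightarrow> 'a + 'a"
    proof -
      define e where "e n = (case s n of Inl x \<Rightarrow> (x, f x) | Inr b \<Rightarrow> (b, b))" for n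
      have \<phi>: "fm_of_lang L \<phi>" and s: "s ` free_vars \<phi> \<subseteq> Inl ` Domain R"
        using that by (auto simp: formulas_over_def formulas_def)
      have "e ` free_vars \<phi> \<subseteq> R" using s f by (fastforce simp: e_def)
      from elementary_relD[OF el \<phi> this]
      show ?thesis
        by (auto simp: holds_def comp_def e_def sum.case_distrib[of fst] sum.case_distrib[of snd]
            cong: sum.case_cong)
    qed
    then show ?thesis unfolding tp_def by auto
  qed
  ultimately obtain \<sigma> where "automorphism L N \<sigma>" "\<forall>x \<in> Domain R. \<sigma> x = f x"
    using monster unfolding monster_model_def strongly_homogeneous_def by blast
  then show ?thesis using that f_eq by (metis DomainI)
qed

section \<open>Extending partial maps between lovely pairs\<close>

abbreviation lovely :: "'a set \<Rightarrow> 'a set \<Rightarrow> bool" where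
  "lovely \<equiv> lovely_pair L N \<mu> ind \<kappa>"

lemma lovelyD:
  assumes "lovely M P"
  shows "P \<subseteq> M" and "small N \<mu> M" and "small N \<mu> P" and "M \<subseteq> univ N" and "closed_under_funs L N M"
  using assms small_subset[of M P]
  by (auto simp: lovely_pair_def elementary_substructure_def)

lemma lovely_density:
  assumes "lovely M P" and "A \<subseteq> M" and "|A| <o \<kappa>" and "c \<in> univ N" and "ind {c} (P \<inter> A) A"
  obtains b where "b \<in> P" and "realizes N b (tp L N A UNIV (\<lambda>_. c))"
proof -
  let ?q = "tp L N A UNIV (\<lambda>_. c) :: ('f, 'r, 'a) type1"
  have "realizes N c ?q" by (simp add: realizes_def tp_def)
  then have "type_ind N ind ?q (P \<inter> A) A"
    using assms(4,5) by (auto simp: type_ind_def)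
  then have "\<exists>b \<in> P. realizes N b ?q"
    using assms(1)[unfolded lovely_pair_def, THEN conjunct2, THEN conjunct2, THEN conjunct2,
        THEN conjunct1, rule_format, of A ?q] assms(2,3) tp_in_complete_types1[OF assms(4)] by simp
  then show ?thesis using that by (elim bexE)
qed

lemma lovely_extension:
  assumes "lovely M P" and "A \<subseteq> M" and "|A| <o \<kappa>" and "c \<in> univ N"
  obtains b where "b \<in> M" and "realizes N b (tp L N A UNIV (\<lambda>_. c))" and "ind {b} A P"
proof -
  let ?q = "tp L N A UNIV (\<lambda>_. c) :: ('f, 'r, 'a) type1"
  have "\<exists>b \<in> M. realizes N b ?q \<and> ind {b} A P"
    using assms(1)[unfolded lovely_pair_def, THEN conjunct2, THEN conjunct2, THEN conjunct2,
        THEN conjunct2, rule_format, of A ?q] assms(2,3) tp_in_complete_types1[OF assms(4)] by simp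
  then show ?thesis using that by (elim bexE conjE)
qed

text \<open>In a lovely pair, the predicate contains every element that is independent from itself over
  a very small part of the predicate.\<close>

lemma self_ind_in_P:
  assumes lov: "lovely M P" and b: "b \<in> M" and D: "D \<subseteq> P" "|D| <o \<kappa>" and ind: "ind {b} D {b}"
  shows "b \<in> P"
proof (rule ccontr)
  assume nb: "b \<notin> P"
  note lovelyD[OF lov]
  then have sm: "small N \<mu> {b}" "small N \<mu> D" and bN: "b \<in> univ N"
    using small_subset b D by auto
  have "ind ({b} \<union> D) D {b}" using ind_normal sm ind by blast
  then have "ind {b} D ({b} \<union> D)" using ind_sym small_Un sm by blast
  moreover have "P \<inter> insert b D = D" using nb D by blast
  ultimately have "ind {b} (P \<inter> insert b D) (insert b D)" by simp
  then obtain b' where "b' \<in> P" "realizes N b' (tp L N (insert b D) UNIV (\<lambda>_. b))"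
    using lovely_density[OF lov _ very_small_insert[OF D(2)] bN] b D lovelyD[OF lov] by blast
  then show False using realizes_tp_member_eq[of N b' L "insert b D" b] nb by auto
qed

text \<open>The positions of the back-and-forth game between \<open>(M, P)\<close> and \<open>(M', P')\<close>: graphs of very small
  partial elementary maps that respect the predicates and have P-independent domain and range.\<close>

definition back_and_forth ::
  "'a set \<Rightarrow> 'a set \<Rightarrow> 'a set \<Rightarrow> 'a set \<Rightarrow> ('a \<times> 'a) set \<Rightarrow> bool" where
  "back_and_forth M P M' P' R \<longleftrightarrow>
     R \<subseteq> M \<times> M' \<and> |R| <o \<kappa> \<and> elementary_rel L N R
     \<and> P_independent ind P (Domain R) \<and> P_independent ind P' (Range R)
     \<and> (\<forall>(x, y) \<in> R. x \<in> P \<longleftrightarrow> y \<in> P')"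

lemma back_and_forth_converse:
  assumes "back_and_forth M P M' P' R"
  shows "back_and_forth M' P' M P (R\<inverse>)"
proof -
  have "|R\<inverse>| <o \<kappa>"
    using assms by (intro very_small_converse) (simp add: back_and_forth_def)
  then show ?thesis
    using assms elementary_rel_converse[of L N R] unfolding back_and_forth_def by auto
qed

context
  fixes M P M' P' :: "'a set"
  assumes lov: "lovely M P" and lov': "lovely M' P'"
begin

lemma back_and_forth_facts:
  assumes "back_and_forth M P M' P' R"
  shows "R \<subseteq> univ N \<times> univ N" and "small N \<mu> (Domain R)" and "small N \<mu> (Range R)"
    and "Domain R \<subseteq> M" and "Range R \<subseteq> M'"
proof -
  show R: "R \<subseteq> univ N \<times> univ N"
    using assms lovelyD(4)[OF lov] lovelyD(4)[OF lov'] unfolding back_and_forth_def by blast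
  show "small N \<mu> (Domain R)" "small N \<mu> (Range R)"
    using assms R unfolding back_and_forth_def
    by (auto intro!: small_if_very_small very_small_Domain very_small_Range)
  show "Domain R \<subseteq> M" "Range R \<subseteq> M'" using assms unfolding back_and_forth_def by auto
qed

text \<open>If a position is extended by pairs of elements of the two predicates, with first components in
  a very small set, and remains elementary, then it remains a position. The new pairs are few because
  elementary maps are injective.\<close>

lemma back_and_forth_extend_in_P:
  assumes bf: "back_and_forth M P M' P' R" and el: "elementary_rel L N S"
    and S: "R \<subseteq> S" "S \<subseteq> R \<union> C \<times> P'" and C: "C \<subseteq> P" "|C| <o \<kappa>"
  shows "back_and_forth M P M' P' S"
proof -
  have R: "|R| <o \<kappa>" "R \<subseteq> M \<times> M'" "\<forall>(x, y) \<in> R. x \<in> P \<longleftrightarrow> y \<in> P'"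
    and indR: "P_independent ind P (Domain R)" "P_independent ind P' (Range R)"
    using bf unfolding back_and_forth_def by auto
  have "|S| <o \<kappa>"
  proof -
    have "inj_on fst S" using elementary_rel_eq_iff[OF el] by (auto simp: inj_on_def)
    moreover have "fst ` S \<subseteq> Domain R \<union> C" using S(2) by force
    ultimately have "|S| \<le>o |Domain R \<union> C|" using card_of_ordLeq by blast
    then show ?thesis
      using very_small_Un[OF very_small_Domain[OF R(1)] C(2)] ordLeq_ordLess_trans by blast
  qed
  moreover have "P_independent ind P (Domain S)"
  proof -
    have "Domain S = Domain R \<union> (Domain S \<inter> C)" using S by blast
    moreover have "P_independent ind P (Domain R \<union> (Domain S \<inter> C))"
      using P_independent_Un[OF back_and_forth_facts(2)[OF bf] lovelyD(3)[OF lov] indR(1)] C by blast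
    ultimately show ?thesis by simp
  qed
  moreover have "P_independent ind P' (Range S)"
  proof -
    have "Range S = Range R \<union> (Range S \<inter> P')" using S by blast
    moreover have "P_independent ind P' (Range R \<union> (Range S \<inter> P'))"
      using P_independent_Un[OF back_and_forth_facts(3)[OF bf] lovelyD(3)[OF lov'] indR(2)] by blast
    ultimately show ?thesis by simp
  qed
  moreover have "S \<subseteq> M \<times> M'" using R S(2) C lovelyD(1)[OF lov] lovelyD(1)[OF lov'] by blast
  moreover have "\<forall>(x, y) \<in> S. x \<in> P \<longleftrightarrow> y \<in> P'" using R(3) S(2) C by blast
  ultimately show ?thesis using el unfolding back_and_forth_def by blast
qed

lemma image_Domain:
  assumes "\<And>x y. (x, y) \<in> R \<Longrightarrow> \<sigma> x = y"
  shows "\<sigma> ` Domain R = Range R"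
  using assms by force

lemma image_P_Domain:
  assumes "back_and_forth M P M' P' R" and "\<And>x y. (x, y) \<in> R \<Longrightarrow> \<sigma> x = y"
  shows "\<sigma> ` (P \<inter> Domain R) = P' \<inter> Range R"
proof (intro equalityI subsetI)
  fix y assume "y \<in> P' \<inter> Range R"
  then obtain x where "(x, y) \<in> R" "y \<in> P'" by blast
  then have "x \<in> P \<inter> Domain R" "\<sigma> x = y" using assms unfolding back_and_forth_def by auto
  then show "y \<in> \<sigma> ` (P \<inter> Domain R)" by blast
next
  fix y assume "y \<in> \<sigma> ` (P \<inter> Domain R)"
  then obtain x where x: "x \<in> P" "x \<in> Domain R" "y = \<sigma> x" by blast
  then obtain z where "(x, z) \<in> R" by blast
  then show "y \<in> P' \<inter> Range R" using assms x unfolding back_and_forth_def by auto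
qed

text \<open>The image of an element \<open>b\<close> of the predicate comes from the density property: P-independence of
  the domain says in particular that \<open>b\<close> is independent from the domain over its part in \<open>P\<close>.\<close>

lemma forth_in_P:
  assumes bf: "back_and_forth M P M' P' R" and b: "b \<in> P"
  obtains b' where "b' \<in> P'" and "elementary_rel L N (insert (b, b') R)"
proof -
  note facts = back_and_forth_facts[OF bf]
  have el: "elementary_rel L N R" and R: "|R| <o \<kappa>" and indR: "ind (Domain R) (P \<inter> Domain R) P"
    using bf unfolding back_and_forth_def P_independent_def by auto
  have sm: "small N \<mu> P" "small N \<mu> (P \<inter> Domain R)" "small N \<mu> {b}"
    using lovelyD(3)[OF lov] small_subset b by auto
  have bN: "b \<in> univ N" using sm(3) by (simp add: small_def)
  obtain \<sigma> where \<sigma>: "automorphism L N \<sigma>" "\<And>x y. (x, y) \<in> R \<Longrightarrow> \<sigma> x = y"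
    using automorphism_extending[OF el facts(1) R] by blast
  then have \<sigma>b: "\<sigma> b \<in> univ N" using bN by (auto simp: automorphism_def bij_betw_def)
  have "ind (Domain R) (P \<inter> Domain R) {b}"
    using ind_mono_right[OF facts(2) sm(2,1) indR] b by blast
  then have "ind {b} (P \<inter> Domain R) (Domain R)" using ind_sym facts(2) sm by blast
  then have "ind (\<sigma> ` {b}) (\<sigma> ` (P \<inter> Domain R)) (\<sigma> ` Domain R)"
    using ind_invariant sm facts(2) \<sigma>(1) by blast
  then have "ind {\<sigma> b} (P' \<inter> Range R) (Range R)"
    using image_P_Domain[OF bf \<sigma>(2)] image_Domain[of R \<sigma>, OF \<sigma>(2)] by simp
  then obtain b' where "b' \<in> P'" "realizes N b' (tp L N (Range R) UNIV (\<lambda>_. \<sigma> b))"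
    using lovely_density[OF lov' facts(5) very_small_Range[OF R] \<sigma>b] by blast
  then show ?thesis
    using that elementary_rel_insert[OF structure_N \<sigma>(1) facts(1) \<sigma>(2) bN] by blast
qed

text \<open>Iterating the previous step over a very small set \<open>C\<close> amounts to taking a maximal elementary
  extension with new pairs in \<open>C \<times> P'\<close>. P-independence and cardinality need no attention in
  the limit, by \<open>back_and_forth_extend_in_P\<close>.\<close>

lemma forth_subset_P:
  assumes bf: "back_and_forth M P M' P' R" and C: "C \<subseteq> P" "|C| <o \<kappa>"
  obtains S where "R \<subseteq> S" and "back_and_forth M P M' P' S" and "Domain S = Domain R \<union> C"
proof -
  define \<A> where "\<A> = {S. R \<subseteq> S \<and> S \<subseteq> R \<union> C \<times> P' \<and> elementary_rel L N S}"
  have "\<exists>S\<in>\<A>. \<forall>X\<in>\<A>. S \<subseteq> X \<longrightarrow> X = S"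
  proof (rule subset_Zorn_nonempty)
    have "R \<in> \<A>" using bf by (simp add: back_and_forth_def \<A>_def)
    then show "\<A> \<noteq> {}" by blast
    fix \<C> assume ne: "\<C> \<noteq> {}" and ch: "subset.chain \<A> \<C>"
    then have sub: "\<And>S. S \<in> \<C> \<Longrightarrow> R \<subseteq> S \<and> S \<subseteq> R \<union> C \<times> P' \<and> elementary_rel L N S"
      by (auto simp: subset_chain_def \<A>_def)
    then have "elementary_rel L N (\<Union>\<C>)" by (intro elementary_rel_Union_chain[OF ch ne]) simp
    moreover have "R \<subseteq> \<Union>\<C>" using sub ne by (meson Union_upper ex_in_conv subset_trans)
    moreover have "\<Union>\<C> \<subseteq> R \<union> C \<times> P'" using sub by (intro Union_least) simp
    ultimately show "\<Union>\<C> \<in> \<A>" by (simp add: \<A>_def)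
  qed
  then obtain S where "S \<in> \<A>" and max: "\<forall>X\<in>\<A>. S \<subseteq> X \<longrightarrow> X = S" ..
  then have S: "R \<subseteq> S" "S \<subseteq> R \<union> C \<times> P'" "elementary_rel L N S" by (simp_all add: \<A>_def)
  have bfS: "back_and_forth M P M' P' S"
    using back_and_forth_extend_in_P[OF bf S(3,1,2) C] .
  have "b \<in> Domain S" if b: "b \<in> C" for b
  proof -
    have "b \<in> P" using b C(1) ..
    then obtain b' where b': "b' \<in> P'" "elementary_rel L N (insert (b, b') S)"
      by (rule forth_in_P[OF bfS])
    then have "insert (b, b') S \<in> \<A>" using S b by (auto simp: \<A>_def)
    then have "insert (b, b') S = S" using max by (simp add: subset_insertI)
    then show ?thesis by (metis DomainI insertI1)
  qed
  then have "Domain S = Domain R \<union> C" using S(1,2) by auto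
  then show ?thesis using that[of S] S(1) bfS by simp
qed

text \<open>The assumption \<open>indb\<close> says that \<open>b\<close> together with the domain is P-independent.\<close>

lemma forth_outside_P:
  assumes bf: "back_and_forth M P M' P' R" and b: "b \<in> M" "b \<notin> P"
    and indb: "ind (insert b (Domain R)) (P \<inter> Domain R) P"
  obtains b' where "back_and_forth M P M' P' (insert (b, b') R)"
proof -
  let ?A = "Domain R" and ?A' = "Range R"
  note facts = back_and_forth_facts[OF bf] and l = lovelyD[OF lov] and l' = lovelyD[OF lov']
  have el: "elementary_rel L N R" and R: "|R| <o \<kappa>" and RM: "R \<subseteq> M \<times> M'"
    and ind': "ind ?A' (P' \<inter> ?A') P'"
    and RP: "\<forall>(x, y) \<in> R. x \<in> P \<longleftrightarrow> y \<in> P'"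
    using bf unfolding back_and_forth_def P_independent_def by auto
  obtain \<sigma> where \<sigma>: "automorphism L N \<sigma>" "\<And>x y. (x, y) \<in> R \<Longrightarrow> \<sigma> x = y"
    using automorphism_extending[OF el facts(1) R] by blast
  have bN: "b \<in> univ N" using b l by blast
  then have \<sigma>b: "\<sigma> b \<in> univ N" using \<sigma>(1) by (auto simp: automorphism_def bij_betw_def)
  obtain b' where b': "b' \<in> M'" "ind {b'} ?A' P'"
    "realizes N b' (tp L N ?A' UNIV (\<lambda>_. \<sigma> b))"
    using lovely_extension[OF lov' facts(5) very_small_Range[OF R] \<sigma>b] by blast
  let ?S = "insert (b, b') R"
  have elS: "elementary_rel L N ?S"
    using elementary_rel_insert[OF structure_N \<sigma>(1) facts(1) \<sigma>(2) bN b'(3)] .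
  have vS: "|?S| <o \<kappa>" using very_small_insert[OF R] .
  have sm': "small N \<mu> {b'}" "small N \<mu> ?A'" "small N \<mu> P'" "small N \<mu> (insert b' ?A')"
      "small N \<mu> (P' \<inter> ?A')"
    using small_subset[OF l'(2)] small_subset[OF l'(3), of "P' \<inter> ?A'"] b'(1) facts(5) l'(3) by auto
  have ind_b': "ind (insert b' ?A') (P' \<inter> ?A') P'"
  proof -
    have "ind ({b'} \<union> ?A') ?A' P'" using ind_normal sm' b'(2) by blast
    then have "ind P' ?A' (insert b' ?A')" using ind_sym[OF sm'(4,2,3)] by simp
    moreover have "ind P' (P' \<inter> ?A') ?A'" using ind_sym sm' ind' by blast
    ultimately have "ind P' (P' \<inter> ?A') (insert b' ?A')"
      using ind_trans_iff[OF sm'(3,4), of "P' \<inter> ?A'" ?A'] by blast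
    then show ?thesis using ind_sym sm' by blast
  qed
  \<comment> \<open>Otherwise \<open>b'\<close> is independent from itself over the part of the range in \<open>P'\<close>; an automorphism
    \<open>\<tau>\<close> that extends the inverse map carries this over to \<open>b\<close>, which would then be in \<open>P\<close>.\<close>
  have "b' \<notin> P'"
  proof
    assume bP': "b' \<in> P'"
    have "ind {b'} (P' \<inter> ?A') P'" using ind_mono_left[OF sm'(4,5,3) ind_b'] by blast
    then have self: "ind {b'} (P' \<inter> ?A') {b'}" using ind_mono_right[OF sm'(1,5,3)] bP' by blast
    have "?S \<subseteq> univ N \<times> univ N" using facts(1) bN b'(1) l' by blast
    then have "?S\<inverse> \<subseteq> univ N \<times> univ N" by blast
    moreover have "|?S\<inverse>| <o \<kappa>"
      using vS by (rule very_small_converse)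
    ultimately obtain \<tau> where \<tau>: "automorphism L N \<tau>" "\<And>x y. (x, y) \<in> ?S\<inverse> \<Longrightarrow> \<tau> x = y"
      using automorphism_extending[OF elementary_rel_converse[OF elS]] by blast
    have "\<tau> ` (P' \<inter> ?A') = P \<inter> ?A"
    proof (intro equalityI subsetI)
      fix x assume "x \<in> P \<inter> ?A"
      then obtain y where "(x, y) \<in> R" "x \<in> P" by blast
      then have "y \<in> P' \<inter> ?A'" "\<tau> y = x" using RP \<tau>(2)[of y x] by auto
      then show "x \<in> \<tau> ` (P' \<inter> ?A')" by blast
    next
      fix x assume "x \<in> \<tau> ` (P' \<inter> ?A')"
      then obtain z y where "(z, y) \<in> R" "y \<in> P'" "x = \<tau> y" by blast
      then show "x \<in> P \<inter> ?A" using RP \<tau>(2)[of y z] by auto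
    qed
    moreover have "\<tau> b' = b" using \<tau>(2)[of b' b] by blast
    ultimately have "ind {b} (P \<inter> ?A) {b}"
      using ind_invariant[OF sm'(1,5,1) \<tau>(1) self] by simp
    moreover have "|P \<inter> ?A| <o \<kappa>" using very_small_subset[OF very_small_Domain[OF R]] by blast
    ultimately show False using self_ind_in_P[OF lov b(1)] b(2) by blast
  qed
  moreover have "P \<inter> Domain ?S = P \<inter> ?A" using b by blast
  moreover have "P' \<inter> Range ?S = P' \<inter> ?A'" using \<open>b' \<notin> P'\<close> by blast
  ultimately have "back_and_forth M P M' P' ?S"
    using elS vS RM RP b b' indb ind_b' unfolding back_and_forth_def P_independent_def by auto
  then show ?thesis using that by blast
qed

lemma forth:
  assumes bf: "back_and_forth M P M' P' R" and b: "b \<in> M"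
  obtains S b' where "R \<subseteq> S" and "(b, b') \<in> S" and "back_and_forth M P M' P' S"
proof (cases "b \<in> P")
  case True
  then obtain b' where b': "b' \<in> P'" "elementary_rel L N (insert (b, b') R)"
    by (rule forth_in_P[OF bf])
  have "back_and_forth M P M' P' (insert (b, b') R)"
    using True b'(1)
    by (intro back_and_forth_extend_in_P[OF bf b'(2), of "{b}"] very_small_finite) auto
  then show ?thesis using that[of "insert (b, b') R" b'] by (simp add: subset_insertI)
next
  case False
  note facts = back_and_forth_facts[OF bf] and l = lovelyD[OF lov]
  let ?B = "insert b (Domain R)"
  have vB: "|?B| <o \<kappa>"
    using bf by (intro very_small_insert very_small_Domain) (simp add: back_and_forth_def)
  have BM: "?B \<subseteq> M" using b facts(4) by simp
  \<comment> \<open>Once \<open>C\<close> is part of the domain, \<open>b\<close> together with the domain is P-independent.\<close>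
  obtain C where C: "C \<subseteq> P" "|C| <o \<kappa>" "ind ?B C P"
    by (rule very_small_base[OF subset_trans[OF BM l(4)] vB l(3)])
  obtain S where S: "R \<subseteq> S" "back_and_forth M P M' P' S" "Domain S = Domain R \<union> C"
    by (rule forth_subset_P[OF bf C(1,2)])
  have smB: "small N \<mu> ?B" using small_subset[OF l(2) BM] .
  have "C \<subseteq> P \<inter> Domain S" using S(3) C(1) by blast
  from ind_trans_iff[OF smB l(3) this Int_lower1] have "ind ?B (P \<inter> Domain S) P"
    using C(3) by simp
  then have "ind (?B \<union> P \<inter> Domain S) (P \<inter> Domain S) P"
    by (rule ind_normal[OF smB l(3) small_subset[OF l(3) Int_lower1]])
  moreover have "?B \<union> P \<inter> Domain S = insert b (Domain S)" using S(3) C(1) by blast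
  ultimately have "ind (insert b (Domain S)) (P \<inter> Domain S) P" by simp
  then obtain b' where "back_and_forth M P M' P' (insert (b, b') S)"
    by (rule forth_outside_P[OF S(2) b False])
  then show ?thesis using that[of "insert (b, b') S" b'] S(1) by (simp add: subset_insertI2)
qed

end

section \<open>Preservation of formulas with the predicate\<close>

lemma lang2_simps [simp]:
  "funs (lang2 L) = funs L"
  "fun_arity (lang2 L) = fun_arity L"
  "rels (lang2 L) = insert None (Some ` rels L)"
  "rel_arity (lang2 L) None = 1"
  "rel_arity (lang2 L) (Some r) = rel_arity L r"
  by (simp_all add: lang2_def)

lemma trm_of_lang2 [simp]: "trm_of_lang (lang2 L) t = trm_of_lang L t"
  by (induction t) auto

lemma pair_struct_simps [simp]:
  "univ (pair_struct N M P) = M"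
  "fun_interp (pair_struct N M P) = fun_interp N"
  "rel_interp (pair_struct N M P) (Some r) = rel_interp N r"
  "rel_interp (pair_struct N M P) None xs \<longleftrightarrow> hd xs \<in> P"
  by (simp_all add: pair_struct_def)

lemma eval_pair_struct [simp]: "eval (pair_struct N M P) = eval N"
proof (intro ext)
  show "eval (pair_struct N M P) e t = eval N e t" for e t
  proof (induction t)
    case (App f ts)
    then have "map (eval (pair_struct N M P) e) ts = map (eval N e) ts" by simp
    then show ?case by (simp only: eval.simps pair_struct_simps)
  qed simp
qed

text \<open>Atomic formulas \<open>P(t)\<close> also use the game: the position is first extended by the value
  of \<open>t\<close>.\<close>

lemma back_and_forth_sat:
  assumes lov: "lovely M P" and lov': "lovely M' P'"
  shows "fm_of_lang (lang2 L) \<phi> \<Longrightarrow> back_and_forth M P M' P' R \<Longrightarrow> e ` free_vars \<phi> \<subseteq> R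
    \<Longrightarrow> sat (pair_struct N M P) (fst \<circ> e) \<phi> = sat (pair_struct N M' P') (snd \<circ> e) \<phi>"
proof (induction \<phi> arbitrary: e R)
  case (Equal s t)
  then show ?case
    using elementary_relD[of L N R "Equal s t" e] by (simp add: back_and_forth_def comp_def)
next
  case (Rel r ts)
  show ?case
  proof (cases r)
    case (Some r')
    then show ?thesis
      using Rel elementary_relD[of L N R "Rel r' ts" e]
      by (auto simp: back_and_forth_def comp_def)
  next
    case None
    then obtain t where ts: "ts = [t]" and t: "trm_of_lang L t"
      using Rel.prems(1) by (auto simp: length_Suc_conv)
    have vt: "e ` trm_vars t \<subseteq> R" using Rel.prems(3) ts by simp
    have "(fst \<circ> e) ` trm_vars t \<subseteq> M" using vt Rel.prems(2) by (force simp: back_and_forth_def)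
    then have "eval N (fst \<circ> e) t \<in> M" using eval_closed[OF lovelyD(5)[OF lov] t] by blast
    then obtain S b' where S: "R \<subseteq> S" "(eval N (fst \<circ> e) t, b') \<in> S" "back_and_forth M P M' P' S"
      using forth[OF lov lov' Rel.prems(2)] by blast
    obtain k where k: "k \<notin> trm_vars t"
      using finite_trm_vars[of t] by (meson ex_new_if_finite infinite_UNIV_nat)
    let ?e = "e(k := (eval N (fst \<circ> e) t, b'))"
    have "eval N (fst \<circ> ?e) t = eval N (fst \<circ> e) t" "eval N (snd \<circ> ?e) t = eval N (snd \<circ> e) t"
      using k by (auto intro!: eval_cong)
    moreover have "?e ` free_vars (Equal t (Var k)) \<subseteq> S" using vt S by auto
    ultimately have "eval N (snd \<circ> e) t = b'"
      using elementary_relD[of L N S "Equal t (Var k)" ?e] t S(3) by (simp add: back_and_forth_def)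
    then have "eval N (fst \<circ> e) t \<in> P \<longleftrightarrow> eval N (snd \<circ> e) t \<in> P'"
      using S(2,3) unfolding back_and_forth_def by blast
    then show ?thesis using None ts by (simp add: comp_def)
  qed
next
  case (Neg \<phi>)
  then show ?case by simp
next
  case (Conj \<phi> \<psi>)
  have "sat (pair_struct N M P) (fst \<circ> e) \<phi> = sat (pair_struct N M' P') (snd \<circ> e) \<phi>"
    using Conj.prems by (intro Conj.IH(1)) auto
  moreover have "sat (pair_struct N M P) (fst \<circ> e) \<psi> = sat (pair_struct N M' P') (snd \<circ> e) \<psi>"
    using Conj.prems by (intro Conj.IH(2)) auto
  ultimately show ?case by (simp only: sat.simps)
next
  case (Exists n \<phi>)
  have step: "sat (pair_struct N M P) ((fst \<circ> e)(n := d)) \<phi>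
      = sat (pair_struct N M' P') ((snd \<circ> e)(n := d')) \<phi>"
    if "R \<subseteq> S" "(d, d') \<in> S" "back_and_forth M P M' P' S" for S d d'
  proof -
    have "(fst \<circ> e)(n := d) = fst \<circ> e(n := (d, d'))" "(snd \<circ> e)(n := d') = snd \<circ> e(n := (d, d'))"
      by auto
    moreover have "e(n := (d, d')) ` free_vars \<phi> \<subseteq> S" using that Exists.prems(3) by auto
    ultimately show ?thesis using Exists.IH[OF _ that(3)] Exists.prems(1)
      by (simp only: fm_of_lang.simps)
  qed
  have "\<exists>d' \<in> M'. sat (pair_struct N M' P') ((snd \<circ> e)(n := d')) \<phi>"
    if d: "d \<in> M" and sat: "sat (pair_struct N M P) ((fst \<circ> e)(n := d)) \<phi>" for d
  proof -
    obtain S d' where S: "R \<subseteq> S" "(d, d') \<in> S" "back_and_forth M P M' P' S"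
      by (rule forth[OF lov lov' Exists.prems(2) d])
    then have "d' \<in> M'" by (auto simp: back_and_forth_def)
    then show ?thesis using step[OF S] sat by blast
  qed
  moreover have "\<exists>d \<in> M. sat (pair_struct N M P) ((fst \<circ> e)(n := d)) \<phi>"
    if d': "d' \<in> M'" and sat: "sat (pair_struct N M' P') ((snd \<circ> e)(n := d')) \<phi>" for d'
  proof -
    obtain S d where S: "R\<inverse> \<subseteq> S" "(d', d) \<in> S" "back_and_forth M' P' M P S"
      by (rule forth[OF lov' lov back_and_forth_converse[OF Exists.prems(2)] d'])
    then have S': "R \<subseteq> S\<inverse>" "(d, d') \<in> S\<inverse>" "back_and_forth M P M' P' (S\<inverse>)"
      using back_and_forth_converse by auto
    then have "d \<in> M" by (auto simp: back_and_forth_def)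
    then show ?thesis using step[OF S'] sat by blast
  qed
  ultimately show ?case unfolding sat.simps pair_struct_simps by blast
qed

end

theorem proposition3p11:
  fixes L :: "('f, 'r) lang"
    and T :: "('f, 'r) fm set"
    and \<CC> :: "('f, 'r, 'a) struct"
    and \<mu> \<kappa>\<^sub>0 \<kappa> :: "'k rel"
    and ind :: "'a set \<Rightarrow> 'a set \<Rightarrow> 'a set \<Rightarrow> bool"
    and M P M' P' :: "'a set"
    and I :: "'i set"
    and a a' :: "'i \<Rightarrow> 'a"
  assumes "complete_theory L T"
    and "monster_model L T \<CC> \<mu>"
    and "independence_relation L \<CC> \<mu> ind"
    and "is_kappa0 \<CC> \<mu> ind \<kappa>\<^sub>0"
    and "Card_order \<kappa>" and "\<kappa> <o \<mu>" and "\<kappa>\<^sub>0 <o \<kappa>" and "|formulas L| <o \<kappa>"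
    and "lovely_pair L \<CC> \<mu> ind \<kappa> M P"
    and "lovely_pair L \<CC> \<mu> ind \<kappa> M' P'"
    and "|I| <o \<kappa>"
    and "a ` I \<subseteq> M" and "P_independent ind P (a ` I)"
    and "a' ` I \<subseteq> M'" and "P_independent ind P' (a' ` I)"
    and same_type: "tp L \<CC> {} I a = tp L \<CC> {} I a'"
    and same_P_type: "\<forall>i \<in> I. a i \<in> P \<longleftrightarrow> a' i \<in> P'"
  shows "tp (lang2 L) (pair_struct \<CC> M P) {} I a = tp (lang2 L) (pair_struct \<CC> M' P') {} I a'"
proof -
  interpret independence_setting L T \<CC> \<mu> \<kappa>\<^sub>0 \<kappa> ind
    using assms(2-7) by unfold_locales (auto simp: is_kappa0_def)
  \<comment> \<open>The game starts from the position given by the two tuples.\<close>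
  let ?R = "(\<lambda>i. (a i, a' i)) ` I"
  have bf: "back_and_forth M P M' P' ?R"
    unfolding back_and_forth_def
  proof (intro conjI)
    show "?R \<subseteq> M \<times> M'" using assms(12,14) by blast
    show "|?R| <o \<kappa>" using assms(11) card_of_image ordLeq_ordLess_trans by blast
    have "Domain ?R = a ` I" "Range ?R = a' ` I" by force+
    then show "P_independent ind P (Domain ?R)" "P_independent ind P' (Range ?R)"
      using assms(13,15) by simp_all
    show "\<forall>(x, y) \<in> ?R. x \<in> P \<longleftrightarrow> y \<in> P'" using same_P_type by auto
    show "elementary_rel L \<CC> ?R"
      unfolding elementary_rel_def
    proof (intro ballI allI impI)
      fix \<phi> and e :: "nat \<Rightarrow> 'a \<times> 'a"
      assume \<phi>: "\<phi> \<in> formulas L" and "e ` free_vars \<phi> \<subseteq> ?R"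
      then have "\<forall>n \<in> free_vars \<phi>. \<exists>i \<in> I. e n = (a i, a' i)" by blast
      then obtain t where t: "\<forall>n \<in> free_vars \<phi>. t n \<in> I \<and> e n = (a (t n), a' (t n))" by metis
      let ?s = "\<lambda>n. Inl (t n) :: 'i + 'a"
      have "(\<phi>, ?s) \<in> formulas_over L I {}" using \<phi> t by (auto simp: formulas_over_def)
      then have "holds \<CC> a (\<phi>, ?s) = holds \<CC> a' (\<phi>, ?s)" using same_type unfolding tp_def by blast
      moreover have "holds \<CC> a (\<phi>, ?s) = sat \<CC> (fst \<circ> e) \<phi>"
        unfolding holds_def prod.case using t by (intro sat_cong) simp
      moreover have "holds \<CC> a' (\<phi>, ?s) = sat \<CC> (snd \<circ> e) \<phi>"
        unfolding holds_def prod.case using t by (intro sat_cong) simp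
      ultimately show "sat \<CC> (fst \<circ> e) \<phi> = sat \<CC> (snd \<circ> e) \<phi>" by simp
    qed
  qed
  have "holds (pair_struct \<CC> M P) a (\<phi>, s) = holds (pair_struct \<CC> M' P') a' (\<phi>, s)"
    if "(\<phi>, s) \<in> formulas_over (lang2 L) I {}" for \<phi> and s :: "nat \<Rightarrow> 'i + 'a"
  proof -
    define e where "e n = (case s n of Inl i \<Rightarrow> (a i, a' i) | Inr b \<Rightarrow> (b, b))" for n
    have \<phi>: "fm_of_lang (lang2 L) \<phi>" and s: "s ` free_vars \<phi> \<subseteq> Inl ` I"
      using that by (auto simp: formulas_over_def formulas_def)
    have "e ` free_vars \<phi> \<subseteq> ?R" using s by (fastforce simp: e_def)
    from back_and_forth_sat[OF assms(9,10) \<phi> bf this]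
    show ?thesis
      by (auto simp: holds_def comp_def e_def sum.case_distrib[of fst] sum.case_distrib[of snd]
          cong: sum.case_cong)
  qed
  then show ?thesis unfolding tp_def by auto
qed

end
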